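(* Let $\mathbb{K}$ be a field, let $L\ge 1$ and $n_1,\dots,n_L\ge 1$ be integers, and let $K^{\rightarrow}_{n_1,\ldots,n_L}$ be the fully-connected feedforward network digraph (MLP) with $L$ layers of widths $n_1,n_2,\ldots,n_L$. Then for every integer $p\ge 0$, the reduced path homology of $K^{\rightarrow}_{n_1,\ldots,n_L}$ with coefficients in $\mathbb{K}$ satisfies $$\operatorname{rank}\, H_p^{\Xi}\bigl(K^{\rightarrow}_{n_1,\ldots,n_L}\bigr)=\delta^{L-1}_p\prod_{i=1}^{L}(n_i-1),$$ where rank means dimension over $\mathbb{K}$ and $\delta^{L-1}_p$ is the Kronecker delta (equal to $1$ if $p=L-1$ and $0$ otherwise).
   Context: The MLP digraph $K^{\rightarrow}_{n_1,\ldots,n_L}$: take pairwise disjoint finite nonempty sets (layers) $K_1,\dots,K_L$ with $|K_i|=n_i$. The vertex set is $\bigcup_{i=1}^L K_i$ and the set of directed edges is $\{(v,v') : v\in K_i,\ v'\in K_{i+1},\ 1\le i\le L-1\}$. Reduced path homology: let $G=(X,E)$ be a finite digraph. For $p\ge 0$, an elementary $p$-path over $X$ is a sequence $(x_0,\dots,x_p)$ of $p+1$ elements of $X$, and $\Lambda_p$ is the free $\mathbb{K}$-vector space on elementary $p$-paths; also $\Lambda_{-1}:=\mathbb{K}$ (spanned by the empty path) and $\Lambda_p:=\{0\}$ for $p\le -2$. The boundary map $\partial_p:\Lambda_p\to\Lambda_{p-1}$ is, for $p\ge 0$, the linear map with $\partial_p(x_0,\dots,x_p)=\sum_{i=0}^p(-1)^i(x_0,\dots,\widehat{x_i},\dots,x_p)$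 (hat denotes omission, so $\partial_0$ sends each vertex to $1\in\mathbb{K}$), and $\partial_p=0$ for $p\le -1$. An elementary $p$-path is allowed if $(x_i,x_{i+1})\in E$ for all $0\le i\le p-1$. $\mathcal{A}_p(G)\subseteq\Lambda_p$ is the span of the allowed $p$-paths for $p\ge 0$; $\mathcal{A}_{-1}:=\mathbb{K}$, $\mathcal{A}_p:=\{0\}$ for $p\le -2$. Put $\Omega_p(G):=\{c\in\mathcal{A}_p(G):\partial_p(c)\in\mathcal{A}_{p-1}(G)\}$. Then $\partial_p$ maps $\Omega_p(G)$ into $\Omega_{p-1}(G)$, giving a chain complex $(\Omega_p(G),\partial_p)$, and for $p\ge 0$ the reduced path homology is $H_p^{\Xi}(G):=\ker(\partial_p|_{\Omega_p(G)})/\operatorname{im}(\partial_{p+1}|_{\Omega_{p+1}(G)})$. *)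

theory Defs
  imports
    "HOL-Algebra.AbelCoset"
    "HOL-Library.Poly_Mapping"
    "Graph_Theory.Pair_Digraph"
    "Jordan_Normal_Form.VS_Connect"
begin

hide_const (open) Multiset.mult Polynomial.smult Modules.module

definition mlp_digraph :: "nat \<Rightarrow> (nat \<Rightarrow> 'v set) \<Rightarrow> 'v pair_pre_digraph" where
  "mlp_digraph L K =
    \<lparr>pverts = (\<Union>i\<in>{1..L}. K i), parcs = (\<Union>i\<in>{1..<L}. K i \<times> K (Suc i))\<rparr>"

text \<open>A path \<open>(x\<^sub>0, \<dots>, x\<^sub>p)\<close> is a list of length \<open>p + 1\<close>. With \<open>p\<close> an integer, this gives
  exactly the empty path for \<open>p = -1\<close> and no path for \<open>p \<le> -2\<close>, so the chain modules below are
  spanned by the empty path and zero, respectively, as in the augmented (reduced) complex.\<close>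

definition elementary_paths :: "'v set \<Rightarrow> int \<Rightarrow> 'v list set" where
  "elementary_paths X p = {xs. set xs \<subseteq> X \<and> int (length xs) = p + 1}"

text \<open>The free vector space \<open>\<Lambda>\<^sub>p\<close>. The multiplicative part of the record plays no role in
  the theory of modules.\<close>

definition chain_module :: "'v set \<Rightarrow> int \<Rightarrow> ('k::field, 'v list \<Rightarrow>\<^sub>0 'k) module" where
  "chain_module X p =
    \<lparr>carrier = {c. Poly_Mapping.keys c \<subseteq> elementary_paths X p},
     mult = undefined, one = undefined, zero = 0, add = (+),
     smult = (\<lambda>a. Poly_Mapping.map ((*) a))\<rparr>"

text \<open>One map serves all degrees: it is the linear extension of
  \<open>xs \<mapsto> \<Sum>\<^sub>i (-1)\<^sup>i \<cdot> (xs without its i-th entry)\<close>, and it vanishes on the empty path.\<close>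

definition boundary :: "('v list \<Rightarrow>\<^sub>0 'k::field) \<Rightarrow> ('v list \<Rightarrow>\<^sub>0 'k)" where
  "boundary c = (\<Sum>xs\<in>Poly_Mapping.keys c. \<Sum>i<length xs.
     Poly_Mapping.single (take i xs @ drop (Suc i) xs) ((-1) ^ i * Poly_Mapping.lookup c xs))"

definition allowed_paths :: "'v pair_pre_digraph \<Rightarrow> int \<Rightarrow> 'v list set" where
  "allowed_paths G p = {xs \<in> elementary_paths (pverts G) p.
     \<forall>i. Suc i < length xs \<longrightarrow> (xs ! i, xs ! Suc i) \<in> parcs G}"

definition allowed_space :: "'v pair_pre_digraph \<Rightarrow> int \<Rightarrow> ('v list \<Rightarrow>\<^sub>0 'k::field) set" where
  "allowed_space G p = LinearCombinations.module.span class_ring (chain_module (pverts G) p)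
     ((\<lambda>xs. Poly_Mapping.single xs 1) ` allowed_paths G p)"

definition Omega :: "'v pair_pre_digraph \<Rightarrow> int \<Rightarrow> ('v list \<Rightarrow>\<^sub>0 'k::field) set" where
  "Omega G p = {c \<in> allowed_space G p. boundary c \<in> allowed_space G (p - 1)}"

definition cycles :: "'v pair_pre_digraph \<Rightarrow> int \<Rightarrow> ('v list \<Rightarrow>\<^sub>0 'k::field) set" where
  "cycles G p = {c \<in> Omega G p. boundary c = 0}"

definition boundaries :: "'v pair_pre_digraph \<Rightarrow> int \<Rightarrow> ('v list \<Rightarrow>\<^sub>0 'k::field) set" where
  "boundaries G p = boundary ` Omega G (p + 1)"

text \<open>As for quotient rings in HOL-Algebra, the operations are defined on cosets without choosing
  representatives: the scalar multiple of a coset is the union of the cosets of the multiples of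
  its elements.\<close>

definition quotient_module :: "('a, 'b, 'm) module_scheme \<Rightarrow> 'b set \<Rightarrow> ('a, 'b set) module" where
  "quotient_module M N =
    \<lparr>carrier = a_rcosets\<^bsub>M\<^esub> N, mult = undefined, one = undefined, zero = N, add = set_add M,
     smult = (\<lambda>a C. \<Union>c\<in>C. N +>\<^bsub>M\<^esub> (a \<odot>\<^bsub>M\<^esub> c))\<rparr>"

definition path_homology ::
    "'v pair_pre_digraph \<Rightarrow> int \<Rightarrow> ('k::field, ('v list \<Rightarrow>\<^sub>0 'k) set) module" where
  "path_homology G p =
    quotient_module (chain_module (pverts G) p\<lparr>carrier := cycles G p\<rparr>) (boundaries G p)"

lemma module_quotient_module:
  assumes "module R M" and "submodule R N M"
  shows "module R (quotient_module M N)"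
proof -
  interpret M: module R M by fact
  interpret S: submodule R N M by fact
  have inv: "\<ominus>\<^bsub>M\<^esub> x \<in> N" if "x \<in> N" for x
  proof -
    have "\<ominus>\<^bsub>M\<^esub> x = (\<ominus>\<^bsub>R\<^esub> \<one>\<^bsub>R\<^esub>) \<odot>\<^bsub>M\<^esub> x"
      using that S.subset M.smult_minus_1 by auto
    then show ?thesis using that by simp
  qed
  have "N \<noteq> {}" using S.zero_closed by blast
  then have sub: "subgroup N (add_monoid M)"
    using S.subset inv by (intro M.add.subgroupI) (auto simp: a_inv_def)
  interpret A: abelian_subgroup N M
    using abelian_subgroupI3[OF additive_subgroupI[OF sub]] M.abelian_group_axioms by blast
  have carr: "carrier (quotient_module M N) = (\<lambda>x. N +>\<^bsub>M\<^esub> x) ` carrier M"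
    by (auto simp: quotient_module_def A_RCOSETS_def' )
  have add: "(N +>\<^bsub>M\<^esub> x) \<oplus>\<^bsub>quotient_module M N\<^esub> (N +>\<^bsub>M\<^esub> y) = N +>\<^bsub>M\<^esub> (x \<oplus>\<^bsub>M\<^esub> y)"
    if "x \<in> carrier M" "y \<in> carrier M" for x y
    using that by (simp add: quotient_module_def A.a_rcos_sum)
  have zero: "\<zero>\<^bsub>quotient_module M N\<^esub> = N +>\<^bsub>M\<^esub> \<zero>\<^bsub>M\<^esub>"
    using S.subset by (simp add: quotient_module_def)
  have smult: "a \<odot>\<^bsub>quotient_module M N\<^esub> (N +>\<^bsub>M\<^esub> x) = N +>\<^bsub>M\<^esub> (a \<odot>\<^bsub>M\<^esub> x)"
    if a: "a \<in> carrier R" and x: "x \<in> carrier M" for a x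
  proof -
    have "N +>\<^bsub>M\<^esub> (a \<odot>\<^bsub>M\<^esub> c) = N +>\<^bsub>M\<^esub> (a \<odot>\<^bsub>M\<^esub> x)" if "c \<in> N +>\<^bsub>M\<^esub> x" for c
    proof -
      from that obtain h where h: "h \<in> N" "c = h \<oplus>\<^bsub>M\<^esub> x" by (auto simp: a_r_coset_def')
      have "a \<odot>\<^bsub>M\<^esub> c = a \<odot>\<^bsub>M\<^esub> h \<oplus>\<^bsub>M\<^esub> a \<odot>\<^bsub>M\<^esub> x"
        using h a x S.subset by (auto simp: M.smult_r_distr)
      then have "a \<odot>\<^bsub>M\<^esub> c \<in> N +>\<^bsub>M\<^esub> (a \<odot>\<^bsub>M\<^esub> x)"
        using h a by (auto simp: a_r_coset_def')
      then show ?thesis using M.a_repr_independence[OF _ _ sub] a x by auto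
    qed
    moreover have "x \<in> N +>\<^bsub>M\<^esub> x" using A.a_rcos_self[OF x] .
    ultimately have "(\<Union>c\<in>N +>\<^bsub>M\<^esub> x. N +>\<^bsub>M\<^esub> (a \<odot>\<^bsub>M\<^esub> c)) = N +>\<^bsub>M\<^esub> (a \<odot>\<^bsub>M\<^esub> x)"
      by blast
    then show ?thesis by (simp add: quotient_module_def)
  qed
  show ?thesis
  proof (rule moduleI)
    show "cring R" ..
    show "abelian_group (quotient_module M N)"
    proof (rule abelian_groupI)
      fix X assume "X \<in> carrier (quotient_module M N)"
      then obtain x where x: "x \<in> carrier M" "X = N +>\<^bsub>M\<^esub> x" by (auto simp: carr)
      then have "(N +>\<^bsub>M\<^esub> (\<ominus>\<^bsub>M\<^esub> x)) \<oplus>\<^bsub>quotient_module M N\<^esub> X = \<zero>\<^bsub>quotient_module M N\<^esub>"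
        by (simp add: add zero M.l_neg)
      then show "\<exists>Y\<in>carrier (quotient_module M N).
          Y \<oplus>\<^bsub>quotient_module M N\<^esub> X = \<zero>\<^bsub>quotient_module M N\<^esub>"
        using x by (auto simp: carr)
    qed (auto simp: carr add zero M.a_ac)
  qed (auto simp: carr add smult M.smult_l_distr M.smult_r_distr M.smult_assoc1)
qed

lemma lookup_map_times [simp]:
  fixes c :: "'a \<Rightarrow>\<^sub>0 'k::field"
  shows "Poly_Mapping.lookup (Poly_Mapping.map ((*) a) c) x = a * Poly_Mapping.lookup c x"
  by transfer (simp add: when_def)

lemma chain_module_simps [simp]:
  "carrier (chain_module X p) = {c. Poly_Mapping.keys c \<subseteq> elementary_paths X p}"
  "\<zero>\<^bsub>chain_module X p\<^esub> = 0"
  "(\<oplus>\<^bsub>chain_module X p\<^esub>) = (+)"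
  "(\<odot>\<^bsub>chain_module X p\<^esub>) = (\<lambda>a. Poly_Mapping.map ((*) a))"
  by (simp_all add: chain_module_def)

lemma module_chain_module:
  "module (class_ring :: 'k::field ring) (chain_module X p :: ('k, 'v list \<Rightarrow>\<^sub>0 'k) module)"
proof (rule moduleI)
  show "cring (class_ring :: 'k ring)" ..
  show "abelian_group (chain_module X p :: ('k, 'v list \<Rightarrow>\<^sub>0 'k) module)"
  proof (rule abelian_groupI)
    fix c :: "'v list \<Rightarrow>\<^sub>0 'k"
    assume "c \<in> carrier (chain_module X p)"
    then show "\<exists>d\<in>carrier (chain_module X p). d \<oplus>\<^bsub>chain_module X p\<^esub> c = \<zero>\<^bsub>chain_module X p\<^esub>"
      by (intro bexI[of _ "- c"]) auto
  qed (auto simp: add.assoc add.commute dest!: subsetD[OF keys_add])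
qed (auto simp: in_keys_iff subset_iff lookup_add algebra_simps intro!: poly_mapping_eqI)

lemma boundary_superset:
  assumes "finite S" and "Poly_Mapping.keys c \<subseteq> S"
  shows "boundary c = (\<Sum>xs\<in>S. \<Sum>i<length xs.
    Poly_Mapping.single (take i xs @ drop (Suc i) xs) ((-1) ^ i * Poly_Mapping.lookup c xs))"
  unfolding boundary_def using assms
  by (intro sum.mono_neutral_left) (auto simp: in_keys_iff)

lemma boundary_zero [simp]: "boundary 0 = 0"
  by (simp add: boundary_def)

lemma boundary_add: "boundary (c + d) = boundary c + boundary d"
proof -
  let ?S = "Poly_Mapping.keys c \<union> Poly_Mapping.keys d"
  have "finite ?S" by simp
  then show ?thesis
    using boundary_superset[of ?S c] boundary_superset[of ?S d]
      boundary_superset[of ?S "c + d"] keys_add[of c d]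
    by (simp add: lookup_add distrib_left single_add sum.distrib)
qed

lemma map_times_add:
  fixes c d :: "'a \<Rightarrow>\<^sub>0 'k::field"
  shows "Poly_Mapping.map ((*) a) (c + d) = Poly_Mapping.map ((*) a) c + Poly_Mapping.map ((*) a) d"
  by (rule poly_mapping_eqI) (simp add: lookup_add algebra_simps)

lemma map_times_sum:
  fixes f :: "'b \<Rightarrow> 'a \<Rightarrow>\<^sub>0 'k::field"
  shows "Poly_Mapping.map ((*) a) (sum f S) = (\<Sum>x\<in>S. Poly_Mapping.map ((*) a) (f x))"
proof (induction S rule: infinite_finite_induct)
  case (insert x S)
  then show ?case by (simp add: map_times_add)
qed (auto intro!: poly_mapping_eqI)

lemma map_times_single:
  fixes b :: "'k::field"
  shows "Poly_Mapping.map ((*) a) (Poly_Mapping.single x b) = Poly_Mapping.single x (a * b)"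
  by (rule poly_mapping_eqI) (simp add: lookup_single when_def)

lemma keys_map_times: "Poly_Mapping.keys (Poly_Mapping.map ((*) (a::'k::field)) c) \<subseteq> Poly_Mapping.keys c"
  by (auto simp: in_keys_iff)

lemma boundary_smult:
  "boundary (Poly_Mapping.map ((*) a) c) = Poly_Mapping.map ((*) a) (boundary c)"
proof -
  have "boundary (Poly_Mapping.map ((*) a) c) = (\<Sum>xs\<in>Poly_Mapping.keys c. \<Sum>i<length xs.
    Poly_Mapping.single (take i xs @ drop (Suc i) xs) ((-1) ^ i * (a * Poly_Mapping.lookup c xs)))"
    by (subst boundary_superset[OF _ keys_map_times]) simp_all
  then show ?thesis
    by (simp add: boundary_def map_times_sum map_times_single mult.left_commute)
qed

lemma boundary_sum: "boundary (sum f S) = (\<Sum>x\<in>S. boundary (f x))"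
  by (induction S rule: infinite_finite_induct) (simp_all add: boundary_add)

lemma boundary_single:
  "boundary (Poly_Mapping.single xs a) =
    (\<Sum>i<length xs. Poly_Mapping.single (take i xs @ drop (Suc i) xs) ((-1) ^ i * a))"
  by (subst boundary_superset[of "{xs}"]) auto

lemma sum_single_lookup:
  "(\<Sum>x\<in>Poly_Mapping.keys c. Poly_Mapping.single x (Poly_Mapping.lookup c x)) = c"
  by (rule poly_mapping_eqI)
    (auto simp: lookup_sum lookup_single when_def in_keys_iff sum.delta)

lemma boundary_boundary_single: "boundary (boundary (Poly_Mapping.single xs a)) = 0"
proof -
  define n where "n = length xs"
  define del where "del = (\<lambda>i (ys :: 'a list). take i ys @ drop (Suc i) ys)"
  define F where "F = (\<lambda>(i, j). Poly_Mapping.single (del j (del i xs)) ((-1) ^ j * ((-1) ^ i * a)))"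
  define A where "A = {(i, j). i < n \<and> j < i}"
  define B where "B = {(i, j). i < n \<and> i \<le> j \<and> j < n - 1}"
  have fin: "finite A" "finite B"
    by (rule finite_subset[of _ "{..<n} \<times> {..<n}"]; force simp: A_def B_def)+
  have len: "length (del i xs) = n - 1" if "i < n" for i
    using that by (simp add: del_def n_def)
  have "boundary (boundary (Poly_Mapping.single xs a)) = (\<Sum>i<n. \<Sum>j<n - 1. F (i, j))"
    using len by (simp add: boundary_single boundary_sum F_def n_def del_def)
  also have "\<dots> = sum F ({..<n} \<times> {..<n - 1})"
    by (simp add: sum.cartesian_product)
  also have "{..<n} \<times> {..<n - 1} = A \<union> B"
    by (auto simp: A_def B_def)
  also have "sum F (A \<union> B) = sum F A + sum F B"
    using fin by (intro sum.union_disjoint) (auto simp: A_def B_def)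
  also have "sum F A = (\<Sum>p\<in>B. - F p)"
  proof (rule sum.reindex_bij_witness[of _ "\<lambda>(i, j). (Suc j, i)" "\<lambda>(i, j). (j, i - 1)"])
    fix p assume "p \<in> A"
    then obtain i j where p: "p = (i, j)" "i < n" "j < i" by (auto simp: A_def)
    have "del j (del i xs) = del (i - 1) (del j xs)"
      using p unfolding del_def n_def
      by (intro nth_equalityI) (auto simp: nth_append min_def intro!: arg_cong[of _ _ "(!) xs"])
    moreover have "(-1) ^ i = - ((-1) ^ (i - 1) :: 'b)"
      using p by (cases i) auto
    ultimately show "- F (case p of (i, j) \<Rightarrow> (j, i - 1)) = F p"
      using p by (simp add: F_def single_uminus mult.left_commute)
  qed (auto simp: A_def B_def)
  finally show ?thesis by (simp add: sum_negf)
qed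

lemma boundary_boundary: "boundary (boundary c) = 0"
proof -
  have "boundary (boundary c) = (\<Sum>x\<in>Poly_Mapping.keys c.
      boundary (boundary (Poly_Mapping.single x (Poly_Mapping.lookup c x))))"
    by (metis (no_types, lifting) boundary_sum sum.cong sum_single_lookup)
  then show ?thesis by (simp add: boundary_boundary_single)
qed

lemma submodule_supported:
  assumes "P \<subseteq> elementary_paths X p"
  shows "submodule (class_ring :: 'k::field ring) {c. Poly_Mapping.keys c \<subseteq> P} (chain_module X p)"
proof (rule submodule.intro)
  show "module (class_ring :: 'k ring) (chain_module X p)" by (rule module_chain_module)
qed (use assms in \<open>auto dest!: subsetD[OF keys_add] subsetD[OF keys_map_times]\<close>)

lemma allowed_space_eq:
  "(allowed_space G p :: ('v list \<Rightarrow>\<^sub>0 'k::field) set) =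
    {c. Poly_Mapping.keys c \<subseteq> allowed_paths G p}"
proof -
  let ?M = "chain_module (pverts G) p :: ('k, 'v list \<Rightarrow>\<^sub>0 'k) module"
  let ?B = "(\<lambda>xs. Poly_Mapping.single xs 1) ` allowed_paths G p :: ('v list \<Rightarrow>\<^sub>0 'k) set"
  interpret M: module class_ring ?M by (rule module_chain_module)
  have sub: "allowed_paths G p \<subseteq> elementary_paths (pverts G) p"
    by (auto simp: allowed_paths_def)
  then have B: "?B \<subseteq> carrier ?M" by auto
  interpret S: submodule class_ring "M.span ?B" ?M
    by (rule M.span_is_submodule[OF B])
  have "M.span ?B \<subseteq> {c. Poly_Mapping.keys c \<subseteq> allowed_paths G p}"
    by (rule M.span_is_subset[OF _ submodule_supported[OF sub]]) auto
  moreover have "c \<in> M.span ?B" if c: "Poly_Mapping.keys c \<subseteq> allowed_paths G p" for c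
  proof -
    have single: "Poly_Mapping.single x a \<in> M.span ?B" if "x \<in> allowed_paths G p" for x a
      using S.smult_closed[of a "Poly_Mapping.single x 1"] that M.in_own_span[OF B]
      by (auto simp: map_times_single)
    have "(\<Sum>x\<in>T. Poly_Mapping.single x (Poly_Mapping.lookup c x)) \<in> M.span ?B"
      if "finite T" "T \<subseteq> allowed_paths G p" for T
      using that
    proof (induction T rule: finite_induct)
      case empty
      then show ?case using S.zero_closed by simp
    next
      case (insert x T)
      then show ?case
        using S.m_closed[OF single[of x "Poly_Mapping.lookup c x"]] by simp
    qed
    from this[OF _ c] show ?thesis by (simp add: sum_single_lookup)
  qed
  ultimately show ?thesis unfolding allowed_space_def by blast
qed

lemma boundary_Omega:
  assumes "c \<in> Omega G p"
  shows "boundary c \<in> Omega G (p - 1)"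
  using assms by (simp add: Omega_def boundary_boundary allowed_space_eq)

lemma add_in_Omega: "c \<in> Omega G p \<Longrightarrow> d \<in> Omega G p \<Longrightarrow> c + d \<in> Omega G p"
  by (auto simp: Omega_def allowed_space_eq boundary_add dest!: subsetD[OF keys_add])

lemma smult_in_Omega: "c \<in> Omega G p \<Longrightarrow> Poly_Mapping.map ((*) a) c \<in> Omega G p"
  by (auto simp: Omega_def allowed_space_eq boundary_smult dest!: subsetD[OF keys_map_times])

lemma zero_in_Omega: "0 \<in> Omega G p"
  by (simp add: Omega_def allowed_space_eq)

lemma Omega_subset: "Omega G p \<subseteq> carrier (chain_module (pverts G) p)"
  by (auto simp: Omega_def allowed_space_eq allowed_paths_def)

lemma map_times_zero [simp]: "Poly_Mapping.map ((*) (a::'k::field)) 0 = 0"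
  by (rule poly_mapping_eqI) simp

lemma submodule_cycles:
  "submodule (class_ring :: 'k::field ring) (cycles G p) (chain_module (pverts G) p)"
proof (rule submodule.intro)
  show "module (class_ring :: 'k ring) (chain_module (pverts G) p)" by (rule module_chain_module)
  show "cycles G p \<subseteq> carrier (chain_module (pverts G) p)"
    using Omega_subset by (auto simp: cycles_def)
qed (auto simp: cycles_def add_in_Omega smult_in_Omega zero_in_Omega boundary_add boundary_smult)

lemma submodule_boundaries:
  "submodule (class_ring :: 'k::field ring) (boundaries G p)
    (chain_module (pverts G) p\<lparr>carrier := cycles G p\<rparr>)"
proof (rule submodule.intro)
  show "module (class_ring :: 'k ring) (chain_module (pverts G) p\<lparr>carrier := cycles G p\<rparr>)"
    by (rule module.submodule_is_module[OF module_chain_module submodule_cycles])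
  show "boundaries G p \<subseteq> carrier (chain_module (pverts G) p\<lparr>carrier := cycles G p\<rparr>)"
    using boundary_Omega[of _ G "p + 1"]
    by (auto simp: boundaries_def cycles_def boundary_boundary)
  show "\<zero>\<^bsub>chain_module (pverts G) p\<lparr>carrier := cycles G p\<rparr>\<^esub> \<in> boundaries G p"
    using zero_in_Omega by (force simp: boundaries_def)
qed (auto simp: boundaries_def boundary_add[symmetric] boundary_smult[symmetric]
      intro: add_in_Omega smult_in_Omega)

lemma vectorspace_path_homology:
  "vectorspace (class_ring :: 'k::field ring) (path_homology G p)"
  unfolding path_homology_def vectorspace_def
  using module_quotient_module[OF module.submodule_is_module[OF module_chain_module
      submodule_cycles] submodule_boundaries] class_field
  by auto

end

theory Submission
  imports Defs
begin

text \<open>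
  Coning a chain \<open>c\<close> off with a vertex \<open>v\<close>, by placing \<open>v\<close> at the front or at the back of every
  path, satisfies \<open>\<partial> (cone c) = c - cone (\<partial> c)\<close> once the cone at the back carries the right signs.
  These identities hold for arbitrary chains, so the only question is when the cone consists of
  allowed paths. An allowed path with \<open>m\<close> vertices picks one vertex from each of the layers
  \<open>a, \<dots>, a + m - 1\<close> for some \<open>a\<close>; it extends to the back unless \<open>a + m - 1 = L\<close> and to the front
  unless \<open>a = 1\<close>. A cycle is an allowed chain with boundary zero: the condition that defines
  \<open>\<Omega>\<close> holds for it automatically.

  Let \<open>0 < m < L\<close> and let \<open>c\<close> be a cycle of paths with \<open>m\<close> vertices, all starting in layer \<open>a\<close> or
  later. If \<open>a + m \<le> L\<close>, cone the part \<open>c\<^sub>1\<close> that starts exactly in layer \<open>a\<close> off at the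
  back with a vertex of layer \<open>a + m\<close>. The rest of \<open>c\<close> has no face starting in layer \<open>a\<close>, so the
  faces of \<open>c\<^sub>1\<close> that do must cancel; what remains of \<open>\<partial> c\<^sub>1\<close> are faces with the first vertex
  omitted. Hence subtracting the boundary of the cone replaces \<open>c\<^sub>1\<close> by paths that start in layer
  \<open>a + 1\<close>. Iterating, all paths of \<open>c\<close> end in layer \<open>L\<close>. They then start after layer \<open>1\<close>, and
  \<open>c\<close> itself is the boundary of its cone at the front. This is \<open>cycle_is_boundary\<close>.

  For \<open>m > L\<close> there are no allowed paths. For \<open>m = L\<close> there are no boundaries, and the homology is
  the space of cycles supported on \<open>K\<^sub>1 \<times> \<dots> \<times> K\<^sub>L\<close>. By disjointness of the layers a face
  remembers which entry was omitted (\<open>lookup_boundary_omit\<close>), so these cycles are the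
  functions whose sum over each single coordinate vanishes. Fix a base vertex \<open>e\<^sub>i\<close> in every layer.
  Such a function is determined by its values at tuples avoiding the base vertices
  (\<open>cycle_eq_0I\<close>), and the products \<open>(z\<^sub>1 - e\<^sub>1) \<cdots> (z\<^sub>L - e\<^sub>L)\<close> with \<open>z\<^sub>i \<noteq> e\<^sub>i\<close>, called
  \<open>join_cycle\<close> below, form the dual basis. There are \<open>\<Prod>\<^sub>i (n\<^sub>i - 1)\<close> of them.
\<close>

abbreviation scale :: "'k::field \<Rightarrow> ('a \<Rightarrow>\<^sub>0 'k) \<Rightarrow> ('a \<Rightarrow>\<^sub>0 'k)" where
  "scale a \<equiv> Poly_Mapping.map ((*) a)"

section \<open>Supports of chains and boundaries\<close>

lemma scale_minus_one: "scale (-1) c = - c"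
  by (rule poly_mapping_eqI) simp

lemma boundary_uminus: "boundary (- c) = - boundary c"
  using boundary_smult[of "-1" c] by (simp add: scale_minus_one)

lemma boundary_diff: "boundary (c - d) = boundary c - boundary d"
  using boundary_add[of c "- d"] by (simp add: boundary_uminus)

lemma keys_diff_subset: "Poly_Mapping.keys (c - d) \<subseteq> Poly_Mapping.keys c \<union> Poly_Mapping.keys d"
  for c d :: "'a \<Rightarrow>\<^sub>0 'k::ab_group_add"
  by (auto simp: in_keys_iff lookup_minus)

lemma keys_sum_subset: "Poly_Mapping.keys (sum f S) \<subseteq> (\<Union>x\<in>S. Poly_Mapping.keys (f x))"
proof (induction S rule: infinite_finite_induct)
  case (insert x S)
  then show ?case using keys_add[of "f x" "sum f S"] by auto
qed auto

lemma keys_boundary: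
  assumes "ys \<in> Poly_Mapping.keys (boundary c)"
  obtains xs i where "xs \<in> Poly_Mapping.keys c" "i < length xs" "ys = take i xs @ drop (Suc i) xs"
proof -
  have "Poly_Mapping.keys (boundary c) \<subseteq>
      (\<Union>xs\<in>Poly_Mapping.keys c. \<Union>i<length xs. {take i xs @ drop (Suc i) xs})"
    unfolding boundary_def
    by (rule order.trans[OF keys_sum_subset] UN_mono order.refl)+ auto
  with assms show ?thesis by (auto intro: that)
qed

section \<open>Linear extension of a weighted map of paths\<close>

definition push :: "('a \<Rightarrow> 'b) \<Rightarrow> ('a \<Rightarrow> 'k) \<Rightarrow> ('a \<Rightarrow>\<^sub>0 'k::field) \<Rightarrow> ('b \<Rightarrow>\<^sub>0 'k)" where
  "push g w c = (\<Sum>x\<in>Poly_Mapping.keys c. Poly_Mapping.single (g x) (w x * Poly_Mapping.lookup c x))"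

lemma push_superset:
  assumes "finite S" "Poly_Mapping.keys c \<subseteq> S"
  shows "push g w c = (\<Sum>x\<in>S. Poly_Mapping.single (g x) (w x * Poly_Mapping.lookup c x))"
  unfolding push_def using assms by (intro sum.mono_neutral_left) (auto simp: in_keys_iff)

lemma push_zero [simp]: "push g w 0 = 0"
  by (simp add: push_def)

lemma push_single: "push g w (Poly_Mapping.single x a) = Poly_Mapping.single (g x) (w x * a)"
  by (subst push_superset[of "{x}"]) auto

lemma push_add: "push g w (c + d) = push g w c + push g w d"
proof -
  let ?S = "Poly_Mapping.keys c \<union> Poly_Mapping.keys d"
  have "finite ?S" by simp
  then show ?thesis
    using push_superset[of ?S c g w] push_superset[of ?S d g w] push_superset[of ?S "c + d" g w]
      keys_add[of c d]
    by (simp add: lookup_add distrib_left single_add sum.distrib)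
qed

lemma push_sum: "push g w (sum f S) = (\<Sum>x\<in>S. push g w (f x))"
  by (induction S rule: infinite_finite_induct) (simp_all add: push_add)

lemma keys_push: "Poly_Mapping.keys (push g w c) \<subseteq> g ` Poly_Mapping.keys c"
  unfolding push_def by (rule order.trans[OF keys_sum_subset]) auto

lemma lookup_push_inj:
  assumes "inj g"
  shows "Poly_Mapping.lookup (push g w c) (g x) = w x * Poly_Mapping.lookup c x"
proof -
  have "Poly_Mapping.lookup (push g w c) (g x) =
      (\<Sum>y\<in>Poly_Mapping.keys c. if x = y then w y * Poly_Mapping.lookup c y else 0)"
    unfolding push_def lookup_sum using assms
    by (intro sum.cong) (auto simp: lookup_single when_def inj_eq)
  then show ?thesis by (simp add: in_keys_iff)
qed

text \<open>Every chain is a sum of monomials; the coefficients are absorbed into the monomials, which is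
  why additivity suffices here.\<close>

lemma additive_eqI:
  fixes F G :: "('a \<Rightarrow>\<^sub>0 'k::field) \<Rightarrow> ('b \<Rightarrow>\<^sub>0 'k)"
  assumes "\<And>c d. F (c + d) = F c + F d" "\<And>c d. G (c + d) = G c + G d" "F 0 = 0" "G 0 = 0"
    and "\<And>x a. F (Poly_Mapping.single x a) = G (Poly_Mapping.single x a)"
  shows "F c = G c"
proof -
  have F: "F (sum f S) = (\<Sum>x\<in>S. F (f x))" and G: "G (sum f S) = (\<Sum>x\<in>S. G (f x))"
    for f and S :: "'a set"
    by (induction S rule: infinite_finite_induct) (simp_all add: assms)
  show ?thesis
    using F[of "\<lambda>x. Poly_Mapping.single x (Poly_Mapping.lookup c x)" "Poly_Mapping.keys c"]
      G[of "\<lambda>x. Poly_Mapping.single x (Poly_Mapping.lookup c x)" "Poly_Mapping.keys c"]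
    by (simp add: sum_single_lookup assms)
qed

section \<open>Cones\<close>

definition cone_front :: "'v \<Rightarrow> ('v list \<Rightarrow>\<^sub>0 'k::field) \<Rightarrow> ('v list \<Rightarrow>\<^sub>0 'k)" where
  "cone_front v = push ((#) v) (\<lambda>_. 1)"

text \<open>The sign is the one that makes the identity for \<open>\<partial>\<close> agree with that of the cone at the front,
  without any assumption that the chain is homogeneous.\<close>

definition cone_back :: "'v \<Rightarrow> ('v list \<Rightarrow>\<^sub>0 'k::field) \<Rightarrow> ('v list \<Rightarrow>\<^sub>0 'k)" where
  "cone_back v = push (\<lambda>xs. xs @ [v]) (\<lambda>xs. (-1) ^ length xs)"

text \<open>Omitting the new vertex gives back \<open>c\<close>; omitting an old one moves its position by one, which
  flips the sign. Paths without vertices are covered, since \<open>\<partial>\<close> maps a vertex to the empty path.\<close>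

lemma boundary_cone_front: "boundary (cone_front v c) = c - cone_front v (boundary c)"
proof (rule additive_eqI[where F = "\<lambda>c. boundary (cone_front v c)"])
  fix xs and a :: 'b
  show "boundary (cone_front v (Poly_Mapping.single xs a)) =
      Poly_Mapping.single xs a - cone_front v (boundary (Poly_Mapping.single xs a))"
    by (simp add: cone_front_def push_single push_sum boundary_single sum.lessThan_Suc_shift
        single_uminus sum_negf del: sum.lessThan_Suc)
qed (simp_all add: cone_front_def push_add boundary_add)

lemma boundary_cone_back: "boundary (cone_back v c) = c - cone_back v (boundary c)"
proof (rule additive_eqI[where F = "\<lambda>c. boundary (cone_back v c)"])
  fix xs and a :: 'b
  have sign: "(-1) ^ n * ((-1) ^ n * a) = a" for n
    by (simp add: mult.assoc[symmetric] power_mult_distrib[symmetric])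
  have "(\<Sum>i<length xs. Poly_Mapping.single (take i (xs @ [v]) @ drop (Suc i) (xs @ [v]))
        ((-1) ^ i * ((-1) ^ length xs * a))) =
      - (\<Sum>i<length xs. Poly_Mapping.single ((take i xs @ drop (Suc i) xs) @ [v])
        ((-1) ^ length (take i xs @ drop (Suc i) xs) * ((-1) ^ i * a)))"
    unfolding sum_negf[symmetric]
  proof (intro sum.cong refl)
    fix i assume "i \<in> {..<length xs}"
    then have i: "i < length xs" by simp
    then have "length (take i xs @ drop (Suc i) xs) = length xs - 1" by simp
    moreover have "(-1) ^ length xs = - ((-1) ^ (length xs - 1) :: 'b)"
      using i by (cases "length xs") auto
    ultimately show "Poly_Mapping.single (take i (xs @ [v]) @ drop (Suc i) (xs @ [v]))
        ((-1) ^ i * ((-1) ^ length xs * a)) =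
      - Poly_Mapping.single ((take i xs @ drop (Suc i) xs) @ [v])
        ((-1) ^ length (take i xs @ drop (Suc i) xs) * ((-1) ^ i * a))"
      using i by (simp add: single_uminus[symmetric] mult.left_commute del: length_append)
  qed
  then show "boundary (cone_back v (Poly_Mapping.single xs a)) =
      Poly_Mapping.single xs a - cone_back v (boundary (Poly_Mapping.single xs a))"
    by (simp add: cone_back_def push_single push_sum boundary_single sign)
qed (simp_all add: cone_back_def push_add boundary_add)

lemma keys_cone_front: "Poly_Mapping.keys (cone_front v c) \<subseteq> (#) v ` Poly_Mapping.keys c"
  unfolding cone_front_def by (rule keys_push)

lemma keys_cone_back: "Poly_Mapping.keys (cone_back v c) \<subseteq> (\<lambda>xs. xs @ [v]) ` Poly_Mapping.keys c"
  unfolding cone_back_def by (rule keys_push)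

lemma cone_front_zero [simp]: "cone_front v 0 = 0"
  by (simp add: cone_front_def)

lemma lookup_cone_front:
  "Poly_Mapping.lookup (cone_front v c) (x # xs) = (if x = v then Poly_Mapping.lookup c xs else 0)"
proof (cases "x = v")
  case True
  then show ?thesis
    using lookup_push_inj[of "(#) v" "\<lambda>_. 1" c xs] by (simp add: cone_front_def)
next
  case False
  then have "x # xs \<notin> Poly_Mapping.keys (cone_front v c)" using keys_cone_front[of v c] by auto
  then show ?thesis using False by (simp add: in_keys_iff)
qed

section \<open>Computing the dimension of path homology from representatives\<close>

lemma cycles_eq:
  "cycles G p = {c. Poly_Mapping.keys c \<subseteq> allowed_paths G p \<and> boundary c = 0}"
  by (auto simp: cycles_def Omega_def allowed_space_eq)

lemma boundariesI:
  assumes "Poly_Mapping.keys w \<subseteq> allowed_paths G (p + 1)"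
    and "Poly_Mapping.keys (boundary w) \<subseteq> allowed_paths G p"
  shows "boundary w \<in> boundaries G p"
  using assms by (auto simp: boundaries_def Omega_def allowed_space_eq)

lemma add_in_boundaries:
  assumes "c \<in> boundaries G p" "d \<in> boundaries G p"
  shows "c + d \<in> boundaries G p"
proof -
  obtain x y where x: "x \<in> Omega G (p + 1)" "c = boundary x"
    and y: "y \<in> Omega G (p + 1)" "d = boundary y"
    using assms unfolding boundaries_def by blast
  have "boundary (x + y) \<in> boundaries G p"
    unfolding boundaries_def by (rule imageI[OF add_in_Omega[OF x(1) y(1)]])
  then show ?thesis by (simp add: boundary_add x y)
qed

text \<open>Bases of homology are handled through representatives and coefficient families, so that no
  later argument mentions cosets. The dimension is transported from the space of coordinate vectors
  along the linear isomorphism \<open>T\<close> that sends a vector to the coset of the corresponding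
  combination of representatives.\<close>

lemma path_homology_dim:
  fixes b :: "'z \<Rightarrow> 'v list \<Rightarrow>\<^sub>0 'k::field"
  assumes fin: "finite Z"
    and cyc: "\<And>z. z \<in> Z \<Longrightarrow> b z \<in> cycles G p"
    and span: "\<And>c. c \<in> cycles G p \<Longrightarrow> \<exists>a. c - (\<Sum>z\<in>Z. scale (a z) (b z)) \<in> boundaries G p"
    and indep: "\<And>a. (\<Sum>z\<in>Z. scale (a z) (b z)) \<in> boundaries G p \<Longrightarrow> \<forall>z\<in>Z. a z = 0"
  shows "vectorspace.fin_dim (class_ring :: 'k ring) (path_homology G p) \<and>
    vectorspace.dim (class_ring :: 'k ring) (path_homology G p) = card Z"
proof -
  let ?N = "boundaries G p :: ('v list \<Rightarrow>\<^sub>0 'k) set"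
  let ?M = "chain_module (pverts G) p\<lparr>carrier := cycles G p\<rparr> :: ('k, 'v list \<Rightarrow>\<^sub>0 'k) module"
  let ?H = "path_homology G p :: ('k, ('v list \<Rightarrow>\<^sub>0 'k) set) module"
  let ?n = "card Z"
  interpret N: submodule "class_ring :: 'k ring" ?N ?M by (rule submodule_boundaries)
  interpret C: submodule "class_ring :: 'k ring" "cycles G p" "chain_module (pverts G) p"
    by (rule submodule_cycles)
  interpret H: vectorspace "class_ring :: 'k ring" ?H by (rule vectorspace_path_homology)
  interpret V: vec_space "TYPE('k)" ?n .
  have add: "x + y \<in> ?N" and smult: "scale a x \<in> ?N"
    if "x \<in> ?N" "y \<in> ?N" for x y a
    using N.m_closed[of x y] N.smult_closed[of a x] that by auto
  have zero: "0 \<in> ?N" using N.zero_closed by simp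
  have uminus: "- x \<in> ?N" if "x \<in> ?N" for x
    using smult[OF that that, of "-1"] by (simp add: scale_minus_one)
  have diff: "x - y \<in> ?N" if "x \<in> ?N" "y \<in> ?N" for x y
    using add[OF that(1) uminus[OF that(2)]] by simp
  define q where "q x = {h + x | h. h \<in> ?N}" for x
  \<comment> \<open>The quotient is first described through \<open>q\<close>, the coset map on bare chains.\<close>
  have q_coset: "?N +>\<^bsub>?M\<^esub> x = q x" for x
    by (auto simp: a_r_coset_def' q_def)
  have q_eq: "q x = q y \<longleftrightarrow> x - y \<in> ?N" for x y
  proof
    assume "q x = q y"
    moreover have "x \<in> q x" using zero by (force simp: q_def)
    ultimately obtain h where "h \<in> ?N" "x = h + y" by (auto simp: q_def)
    then show "x - y \<in> ?N" by simp
  next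
    assume xy: "x - y \<in> ?N"
    have "h + x = (h + (x - y)) + y" "h + y = (h - (x - y)) + x" for h by auto
    then show "q x = q y" using add[OF _ xy] diff[OF _ xy] unfolding q_def by blast
  qed
  have q_add: "q x \<oplus>\<^bsub>?H\<^esub> q y = q (x + y)" for x y
  proof -
    have "q x \<oplus>\<^bsub>?H\<^esub> q y = {u + v | u v. u \<in> q x \<and> v \<in> q y}"
      by (auto simp: path_homology_def quotient_module_def set_add_def')
    also have "\<dots> = q (x + y)"
    proof (intro Set.set_eqI iffI)
      fix z assume "z \<in> {u + v | u v. u \<in> q x \<and> v \<in> q y}"
      then obtain h k where "h \<in> ?N" "k \<in> ?N" "z = (h + x) + (k + y)" by (auto simp: q_def)
      then have "z = (h + k) + (x + y)" "h + k \<in> ?N" using add by (auto simp: algebra_simps)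
      then show "z \<in> q (x + y)" unfolding q_def by blast
    next
      fix z assume "z \<in> q (x + y)"
      then obtain h where h: "h \<in> ?N" "z = (h + x) + (0 + y)" by (auto simp: q_def algebra_simps)
      then show "z \<in> {u + v | u v. u \<in> q x \<and> v \<in> q y}" using zero unfolding q_def by blast
    qed
    finally show ?thesis .
  qed
  have q_smult: "a \<odot>\<^bsub>?H\<^esub> q x = q (scale a x)" for a x
  proof -
    have "q (scale a c) = q (scale a x)" if c: "c \<in> q x" for c
    proof -
      obtain h where "h \<in> ?N" "c = h + x" using c by (auto simp: q_def)
      then show ?thesis unfolding q_eq using smult[of h h a] by (simp add: map_times_add)
    qed
    moreover have "x \<in> q x" using zero by (force simp: q_def)
    ultimately have "(\<Union>c\<in>q x. q (scale a c)) = q (scale a x)" by blast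
    then show ?thesis by (simp add: path_homology_def quotient_module_def q_coset)
  qed
  have H_carrier: "carrier ?H = q ` cycles G p"
    by (auto simp: path_homology_def quotient_module_def A_RCOSETS_def' q_coset)
  obtain e where e: "bij_betw e {..<?n} Z"
    using ex_bij_betw_nat_finite[OF fin] by (auto simp: atLeast0LessThan)
  define comb where "comb v = (\<Sum>j<?n. scale (v $ j) (b (e j)))" for v
  have comb_cycle: "comb v \<in> cycles G p" for v
  proof -
    have "(\<Sum>j\<in>J. scale (v $ j) (b (e j))) \<in> cycles G p" if "J \<subseteq> {..<?n}" for J
      using that
    proof (induction J rule: infinite_finite_induct)
      case (insert j J)
      then have "b (e j) \<in> cycles G p" using cyc e by (auto dest: bij_betwE)
      with insert show ?case
        using C.m_closed C.smult_closed[of "v $ j" "b (e j)"] by simp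
    qed (use C.zero_closed in auto)
    then show ?thesis by (simp add: comb_def)
  qed
  have comb_vec: "comb (vec ?n (\<lambda>j. a (e j))) = (\<Sum>z\<in>Z. scale (a z) (b z))" for a
    unfolding comb_def using sum.reindex_bij_betw[OF e, of "\<lambda>z. scale (a z) (b z)"] by simp
  have comb_add: "comb (u + v) = comb u + comb v"
    if "u \<in> carrier_vec ?n" "v \<in> carrier_vec ?n" for u v
    using that unfolding comb_def sum.distrib[symmetric]
    by (intro sum.cong poly_mapping_eqI) (auto simp: lookup_add distrib_right)
  have comb_smult: "comb (a \<cdot>\<^sub>v v) = scale a (comb v)" if "v \<in> carrier_vec ?n" for a v
    using that unfolding comb_def map_times_sum
    by (intro sum.cong poly_mapping_eqI) auto
  define T where "T v = q (comb v)" for v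
  have T_hom: "T \<in> LinearCombinations.module_hom class_ring (module_vec TYPE('k) ?n) ?H"
    using comb_cycle
    by (auto simp: LinearCombinations.module_hom_def module_vec_simps H_carrier T_def q_add q_smult
        comb_add comb_smult)
  interpret T: linear_map "class_ring :: 'k ring" "module_vec TYPE('k) ?n" ?H T
    by (intro linear_map.intro mod_hom.intro mod_hom_axioms.intro T_hom V.vectorspace_axioms
        H.vectorspace_axioms V.module_axioms H.module_axioms)
  have inj: "inj_on T (carrier_vec ?n)"
  proof (rule inj_onI)
    fix u v assume uv: "u \<in> carrier_vec ?n" "v \<in> carrier_vec ?n" and "T u = T v"
    then have "comb u - comb v \<in> ?N" by (simp add: T_def q_eq)
    \<comment> \<open>Independence is stated for families over \<open>Z\<close>, so the difference of the coordinate vectors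
      is carried over along \<open>e\<close>.\<close>
    moreover define a where "a z = u $ the_inv_into {..<?n} e z - v $ the_inv_into {..<?n} e z" for z
    have a: "a (e j) = u $ j - v $ j" if "j < ?n" for j
      using the_inv_into_f_f[of e "{..<?n}" j] e that by (simp add: a_def bij_betw_def)
    have "comb u - comb v = comb (vec ?n (\<lambda>j. a (e j)))"
      unfolding comb_def sum_subtractf[symmetric]
      by (intro sum.cong poly_mapping_eqI) (auto simp: a lookup_minus algebra_simps)
    ultimately have "(\<Sum>z\<in>Z. scale (a z) (b z)) \<in> ?N" by (simp add: comb_vec)
    then have "\<forall>z\<in>Z. a z = 0" by (rule indep)
    then have "u $ j = v $ j" if "j < ?n" for j
      using a[OF that] e that by (auto dest: bij_betwE)
    then show "u = v" using uv by (intro eq_vecI) auto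
  qed
  have surj: "T ` carrier_vec ?n = carrier ?H"
  proof
    show "T ` carrier_vec ?n \<subseteq> carrier ?H" using comb_cycle by (auto simp: T_def H_carrier)
    show "carrier ?H \<subseteq> T ` carrier_vec ?n"
    proof
      fix X assume "X \<in> carrier ?H"
      then obtain c where c: "c \<in> cycles G p" "X = q c" by (auto simp: H_carrier)
      obtain a where "c - (\<Sum>z\<in>Z. scale (a z) (b z)) \<in> ?N" using span[OF c(1)] by blast
      then have "X = T (vec ?n (\<lambda>j. a (e j)))" by (simp add: c T_def comb_vec q_eq)
      then show "X \<in> T ` carrier_vec ?n" by auto
    qed
  qed
  have "H.fin_dim" using T.surj_fin_dim V.fin_dim surj by (simp add: module_vec_simps)
  moreover have "H.dim = ?n"
    using T.dim_eq V.fin_dim V.dim_is_n inj surj by (simp add: module_vec_simps)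
  ultimately show ?thesis by simp
qed


section \<open>Products of differences of vertices\<close>

text \<open>The product \<open>(z\<^sub>1 - e\<^sub>1) \<cdots> (z\<^sub>n - e\<^sub>n)\<close> in the concatenation algebra of paths: geometrically the
  join of the \<open>0\<close>-spheres \<open>{e\<^sub>i, z\<^sub>i}\<close>, i.e. the boundary sphere of a cross-polytope.\<close>

fun join_cycle :: "'v list \<Rightarrow> 'v list \<Rightarrow> ('v list \<Rightarrow>\<^sub>0 'k::field)" where
  "join_cycle (e # es) (z # zs) =
    cone_front z (join_cycle es zs) - cone_front e (join_cycle es zs)"
| "join_cycle _ _ = Poly_Mapping.single [] 1"

text \<open>In the boundary of a difference of two cones over the same cycle, the two copies of that cycle
  cancel.\<close>

lemma boundary_join_cycle: "boundary (join_cycle es zs :: 'v list \<Rightarrow>\<^sub>0 'k::field) = 0"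
proof (induction es zs rule: join_cycle.induct)
  case (1 e es z zs)
  then show ?case by (simp add: boundary_diff boundary_cone_front)
qed (simp_all add: boundary_single)

lemma keys_join_cycle:
  assumes "length es = length zs"
  shows "Poly_Mapping.keys (join_cycle es zs :: 'v list \<Rightarrow>\<^sub>0 'k::field) \<subseteq>
    {xs. length xs = length zs \<and> (\<forall>i<length zs. xs ! i \<in> {es ! i, zs ! i})}"
  using assms
proof (induction es zs rule: join_cycle.induct)
  case (1 e es z zs)
  show ?case
  proof
    let ?j = "join_cycle es zs :: 'v list \<Rightarrow>\<^sub>0 'k"
    fix xs assume "xs \<in> Poly_Mapping.keys (join_cycle (e # es) (z # zs) :: 'v list \<Rightarrow>\<^sub>0 'k)"
    then obtain x ys where "x \<in> {e, z}" "xs = x # ys"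
      "ys \<in> Poly_Mapping.keys ?j"
      using keys_diff_subset[of "cone_front z ?j" "cone_front e ?j"]
        keys_cone_front[of z ?j] keys_cone_front[of e ?j]
      by simp blast
    then show "xs \<in> {xs. length xs = length (z # zs) \<and>
        (\<forall>i<length (z # zs). xs ! i \<in> {(e # es) ! i, (z # zs) ! i})}"
      using 1 by (auto simp: All_less_Suc2)
  qed
qed auto

text \<open>Expanding the product, the only term without a factor from \<open>es\<close> is \<open>zs\<close> itself. So the join
  cycles are dual to the coefficients at tuples avoiding \<open>es\<close>, which gives their independence and
  reads off the coefficients of any combination of them.\<close>

lemma lookup_join_cycle:
  assumes "length es = length zs" "length xs = length zs" "\<forall>i<length zs. xs ! i \<noteq> es ! i"
  shows "Poly_Mapping.lookup (join_cycle es zs :: 'v list \<Rightarrow>\<^sub>0 'k::field) xs = (if xs = zs then 1 else 0)"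
  using assms
proof (induction es zs arbitrary: xs rule: join_cycle.induct)
  case (1 e es z zs)
  then obtain x ys where "xs = x # ys" by (cases xs) auto
  with 1 show ?case by (auto simp: All_less_Suc2 lookup_minus lookup_cone_front)
qed (auto simp: lookup_single)

section \<open>Cycles meeting every layer\<close>

lemma finite_lists_nth_in:
  assumes "\<And>i. i < n \<Longrightarrow> finite (A i)"
  shows "finite {xs. length xs = n \<and> (\<forall>i<n. xs ! i \<in> A i)}"
    and "card {xs. length xs = n \<and> (\<forall>i<n. xs ! i \<in> A i)} = (\<Prod>i<n. card (A i))"
proof -
  have bij: "bij_betw (\<lambda>f. map f [0..<n]) (PiE {..<n} A) {xs. length xs = n \<and> (\<forall>i<n. xs ! i \<in> A i)}"
    by (rule bij_betw_byWitness[where f' = "\<lambda>xs. restrict ((!) xs) {..<n}"])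
      (auto simp: PiE_def extensional_def fun_eq_iff intro!: nth_equalityI)
  show "finite {xs. length xs = n \<and> (\<forall>i<n. xs ! i \<in> A i)}"
    using bij_betw_finite[OF bij] finite_PiE[of "{..<n}" A] assms by auto
  show "card {xs. length xs = n \<and> (\<forall>i<n. xs ! i \<in> A i)} = (\<Prod>i<n. card (A i))"
    using bij_betw_same_card[OF bij] by (simp add: card_PiE)
qed

text \<open>If a face arose by omitting entries at two different positions, then at the earlier one of them
  the entry of the face would have to lie in two consecutive layers at once, which their disjointness
  forbids. So only the tuples that differ from \<open>xs\<close> in the \<open>i\<close>-th entry share the face, and no
  cancellation between different positions takes place.\<close>

lemma lookup_boundary_omit:
  fixes c :: "'v list \<Rightarrow>\<^sub>0 'k::field"
  assumes fin: "\<And>i. i < n \<Longrightarrow> finite (A i)"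
    and disj: "\<And>i. Suc i < n \<Longrightarrow> A i \<inter> A (Suc i) = {}"
    and supp: "Poly_Mapping.keys c \<subseteq> {xs. length xs = n \<and> (\<forall>i<n. xs ! i \<in> A i)}"
    and xs: "length xs = n" "\<forall>i<n. xs ! i \<in> A i" and i: "i < n"
  shows "Poly_Mapping.lookup (boundary c) (take i xs @ drop (Suc i) xs) =
    (-1) ^ i * (\<Sum>x\<in>A i. Poly_Mapping.lookup c (xs[i := x]))"
proof -
  let ?P = "{xs. length xs = n \<and> (\<forall>i<n. xs ! i \<in> A i)}"
  let ?del = "\<lambda>j ys. take j ys @ drop (Suc j) ys"
  have omit: "j = i \<and> ys = xs[i := ys ! i]" if ys: "ys \<in> ?P" and j: "j < n"
    and eq: "?del j ys = ?del i xs" for j ys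
  proof -
    have nth_del: "?del k zs ! l = zs ! (if l < k then l else Suc l)"
      if "length zs = n" "k < n" "l < n - 1" for k l and zs :: "'v list"
      using that by (auto simp: nth_append)
    have nth: "ys ! (if l < j then l else Suc l) = xs ! (if l < i then l else Suc l)" if "l < n - 1" for l
      using that eq nth_del[of ys j l] nth_del[of xs i l] ys j xs(1) i by simp
    have "j = i"
    proof (rule ccontr)
      assume "j \<noteq> i"
      then consider "j < i" | "i < j" by linarith
      then show False
      proof cases
        case 1
        then have "ys ! Suc j = xs ! j" using nth[of j] i by simp
        moreover have "ys ! Suc j \<in> A (Suc j)" "xs ! j \<in> A j" using ys xs 1 i by auto
        ultimately show False using disj[of j] 1 i by auto
      next
        case 2
        then have "ys ! i = xs ! Suc i" using nth[of i] j by simp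
        moreover have "ys ! i \<in> A i" "xs ! Suc i \<in> A (Suc i)" using ys xs 2 j by auto
        ultimately show False using disj[of i] 2 j by auto
      qed
    qed
    moreover have "ys = xs[i := ys ! i]"
    proof (rule nth_equalityI)
      fix l assume l: "l < length ys"
      show "ys ! l = xs[i := ys ! i] ! l"
      proof (cases "l \<le> i")
        case True
        then show ?thesis using nth[of l] l ys xs i \<open>j = i\<close> by (auto simp: le_less)
      next
        case False
        then have "l - 1 < n - 1" "\<not> l - 1 < i" "Suc (l - 1) = l" using l ys by auto
        then show ?thesis using nth[of "l - 1"] False \<open>j = i\<close> by simp
      qed
    qed (use ys xs in simp)
    ultimately show ?thesis by simp
  qed
  have finP: "finite ?P" using fin by (rule finite_lists_nth_in(1))
  have inj: "inj_on (\<lambda>x. xs[i := x]) (A i)"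
    using i xs(1) by (intro inj_onI) (metis nth_list_update_eq)
  have sub: "(\<lambda>x. xs[i := x]) ` A i \<subseteq> ?P"
    using xs i by (auto simp: nth_list_update)
  have del_upd: "?del i (xs[i := x]) = ?del i xs" for x by simp
  have "Poly_Mapping.lookup (boundary c) (?del i xs) =
      (\<Sum>ys\<in>?P. \<Sum>j<length ys. if ?del j ys = ?del i xs then (-1) ^ j * Poly_Mapping.lookup c ys else 0)"
    unfolding boundary_superset[OF finP supp]
    by (simp add: lookup_sum lookup_single when_def)
  also have "\<dots> = (\<Sum>ys\<in>?P. if ys \<in> (\<lambda>x. xs[i := x]) ` A i then (-1) ^ i * Poly_Mapping.lookup c ys else 0)"
  proof (rule sum.cong[OF refl])
    fix ys assume ys: "ys \<in> ?P"
    have "(\<Sum>j<length ys. if ?del j ys = ?del i xs then (-1) ^ j * Poly_Mapping.lookup c ys else 0) =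
        (\<Sum>j<n. if j = i then if ys \<in> (\<lambda>x. xs[i := x]) ` A i
          then (-1) ^ i * Poly_Mapping.lookup c ys else 0 else 0)"
    proof (rule sum.cong)
      fix j assume "j \<in> {..<n}"
      then have j: "j < n" by simp
      have "?del j ys = ?del i xs \<longleftrightarrow> j = i \<and> ys \<in> (\<lambda>x. xs[i := x]) ` A i"
      proof
        assume "?del j ys = ?del i xs"
        then have "j = i" "ys = xs[i := ys ! i]" using omit[OF ys j] by auto
        then show "j = i \<and> ys \<in> (\<lambda>x. xs[i := x]) ` A i" using ys i by auto
      qed (auto simp: del_upd)
      then show "(if ?del j ys = ?del i xs then (-1) ^ j * Poly_Mapping.lookup c ys else 0) =
          (if j = i then if ys \<in> (\<lambda>x. xs[i := x]) ` A i
          then (-1) ^ i * Poly_Mapping.lookup c ys else 0 else 0)" by auto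
    qed (use ys in simp)
    then show "(\<Sum>j<length ys. if ?del j ys = ?del i xs then (-1) ^ j * Poly_Mapping.lookup c ys else 0) =
        (if ys \<in> (\<lambda>x. xs[i := x]) ` A i then (-1) ^ i * Poly_Mapping.lookup c ys else 0)"
      using i by simp
  qed
  also have "\<dots> = (\<Sum>ys\<in>(\<lambda>x. xs[i := x]) ` A i. (-1) ^ i * Poly_Mapping.lookup c ys)"
    using finP sub by (simp add: sum.If_cases Int_absorb1)
  also have "\<dots> = (-1) ^ i * (\<Sum>x\<in>A i. Poly_Mapping.lookup c (xs[i := x]))"
    by (simp add: sum.reindex[OF inj] sum_distrib_left)
  finally show ?thesis .
qed

text \<open>Induction on the number of base entries of a tuple: if \<open>xs ! i = e i\<close>, then the coefficients of
  the tuples obtained by varying the \<open>i\<close>-th entry add up to zero, and all of them except that of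
  \<open>xs\<close> belong to tuples with fewer base entries.\<close>

lemma cycle_eq_0I:
  fixes c :: "'v list \<Rightarrow>\<^sub>0 'k::field"
  assumes fin: "\<And>i. i < n \<Longrightarrow> finite (A i)"
    and disj: "\<And>i. Suc i < n \<Longrightarrow> A i \<inter> A (Suc i) = {}"
    and supp: "Poly_Mapping.keys c \<subseteq> {xs. length xs = n \<and> (\<forall>i<n. xs ! i \<in> A i)}"
    and cycle: "boundary c = 0"
    and base: "\<And>i. i < n \<Longrightarrow> e i \<in> A i"
    and off_base: "\<And>xs. length xs = n \<Longrightarrow> \<forall>i<n. xs ! i \<in> A i - {e i} \<Longrightarrow> Poly_Mapping.lookup c xs = 0"
  shows "c = 0"
proof -
  have "Poly_Mapping.lookup c xs = 0" if "length xs = n" "\<forall>i<n. xs ! i \<in> A i" for xs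
    using that
  proof (induction "card {i. i < n \<and> xs ! i = e i}" arbitrary: xs rule: less_induct)
    case less
    show ?case
    proof (cases "\<exists>i<n. xs ! i = e i")
      case False
      then show ?thesis using less.prems by (intro off_base) auto
    next
      case True
      then obtain i where i: "i < n" "xs ! i = e i" by blast
      have "Poly_Mapping.lookup c (xs[i := x]) = 0" if x: "x \<in> A i - {e i}" for x
      proof (rule less.hyps)
        have "{j. j < n \<and> xs[i := x] ! j = e j} \<subset> {j. j < n \<and> xs ! j = e j}"
          using i x less.prems by (auto simp: nth_list_update split: if_splits)
        then show "card {j. j < n \<and> xs[i := x] ! j = e j} < card {j. j < n \<and> xs ! j = e j}"
          by (intro psubset_card_mono) auto
      qed (use i x less.prems in \<open>auto simp: nth_list_update\<close>)
      then have "(\<Sum>x\<in>A i. Poly_Mapping.lookup c (xs[i := x])) = Poly_Mapping.lookup c (xs[i := e i])"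
        using fin[OF i(1)] base[OF i(1)] by (simp add: sum.remove)
      moreover have "(\<Sum>x\<in>A i. Poly_Mapping.lookup c (xs[i := x])) = 0"
        using lookup_boundary_omit[OF fin disj supp less.prems i(1)] cycle by simp
      ultimately show ?thesis using i by (metis list_update_id)
    qed
  qed
  then have "Poly_Mapping.lookup c xs = 0" for xs
    using supp in_keys_iff[of xs c] by blast
  then show ?thesis by (intro poly_mapping_eqI) simp
qed

section \<open>The path complex of a feedforward network\<close>

locale network_layers =
  fixes L :: nat and K :: "nat \<Rightarrow> 'v set"
  assumes L_pos: "1 \<le> L"
    and fin: "\<And>i. i \<in> {1..L} \<Longrightarrow> finite (K i)"
    and nonempty: "\<And>i. i \<in> {1..L} \<Longrightarrow> K i \<noteq> {}"
    and disj: "disjoint_family_on K {1..L}"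
begin

definition layered :: "nat \<Rightarrow> nat \<Rightarrow> 'v list set" where
  "layered a m = {xs. length xs = m \<and> (\<forall>i<m. xs ! i \<in> K (a + i))}"

lemma layer_unique: "x \<in> K i \<Longrightarrow> x \<in> K j \<Longrightarrow> i \<in> {1..L} \<Longrightarrow> j \<in> {1..L} \<Longrightarrow> i = j"
  using disj unfolding disjoint_family_on_def by blast

text \<open>The upper bound \<open>Suc L - m\<close> makes the last layer \<open>a + m - 1\<close> at most \<open>L\<close>. Truncated
  subtraction leaves no \<open>a\<close> at all when \<open>m > L\<close>, as it should. For \<open>m = 0\<close> every \<open>a\<close> contributes
  just the empty path.\<close>

lemma allowed_paths_eq:
  "allowed_paths (mlp_digraph L K) (int m - 1) = (\<Union>a\<in>{1..Suc L - m}. layered a m)"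
proof (cases "m = 0")
  case True
  then show ?thesis
    using L_pos by (auto simp: allowed_paths_def elementary_paths_def layered_def)
next
  case False
  show ?thesis
  proof (intro equalityI subsetI)
    fix xs assume "xs \<in> allowed_paths (mlp_digraph L K) (int m - 1)"
    then have len: "length xs = m" and V: "set xs \<subseteq> (\<Union>i\<in>{1..L}. K i)"
      and E: "\<And>i. Suc i < m \<Longrightarrow> (xs ! i, xs ! Suc i) \<in> (\<Union>i\<in>{1..<L}. K i \<times> K (Suc i))"
      by (auto simp: allowed_paths_def elementary_paths_def mlp_digraph_def)
    have "xs ! 0 \<in> set xs" using len False by simp
    then obtain a where a: "a \<in> {1..L}" "xs ! 0 \<in> K a" using V by blast
    have "xs ! i \<in> K (a + i) \<and> a + i \<le> L" if "i < m" for i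
      using that
    proof (induction i)
      case (Suc i)
      then have IH: "xs ! i \<in> K (a + i)" "a + i \<le> L" by auto
      obtain j where j: "j \<in> {1..<L}" "xs ! i \<in> K j" "xs ! Suc i \<in> K (Suc j)"
        using E[of i] Suc.prems by auto
      then have "j = a + i" using layer_unique[of "xs ! i" j "a + i"] IH a by auto
      then show ?case using j by auto
    qed (use a in auto)
    from this this[of "m - 1"] False a len
    show "xs \<in> (\<Union>a\<in>{1..Suc L - m}. layered a m)"
      by (auto simp: layered_def intro!: bexI[of _ a])
  next
    fix xs assume "xs \<in> (\<Union>a\<in>{1..Suc L - m}. layered a m)"
    then obtain a where a: "1 \<le> a" "a + m \<le> Suc L" "length xs = m" "\<And>i. i < m \<Longrightarrow> xs ! i \<in> K (a + i)"
      using False by (auto simp: layered_def)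
    have "set xs \<subseteq> (\<Union>i\<in>{1..L}. K i)"
    proof
      fix x assume "x \<in> set xs"
      then obtain i where "i < m" "x = xs ! i" using a(3) by (auto simp: in_set_conv_nth)
      then show "x \<in> (\<Union>i\<in>{1..L}. K i)" using a by (intro UN_I[of "a + i"]) auto
    qed
    moreover have "(xs ! i, xs ! Suc i) \<in> (\<Union>i\<in>{1..<L}. K i \<times> K (Suc i))" if "Suc i < m" for i
      using a(4)[of i] a(4)[of "Suc i"] a(1,2) that by (intro UN_I[of "a + i"]) auto
    ultimately show "xs \<in> allowed_paths (mlp_digraph L K) (int m - 1)"
      using a(3) by (auto simp: allowed_paths_def elementary_paths_def mlp_digraph_def)
  qed
qed

lemma layered_subset_allowed_paths:
  assumes "1 \<le> a" "a + m \<le> Suc L"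
  shows "layered a m \<subseteq> allowed_paths (mlp_digraph L K) (int m - 1)"
  unfolding allowed_paths_eq using assms by (intro UN_upper) auto

lemma cons_layered: "v \<in> K a \<Longrightarrow> xs \<in> layered (Suc a) m \<Longrightarrow> v # xs \<in> layered a (Suc m)"
  by (auto simp: layered_def nth_Cons split: nat.splits)

lemma snoc_layered: "xs \<in> layered a m \<Longrightarrow> v \<in> K (a + m) \<Longrightarrow> xs @ [v] \<in> layered a (Suc m)"
  by (auto simp: layered_def nth_append less_Suc_eq)

text \<open>The induction pushes the first starting layer \<open>a\<close> of
  the cycle up to its maximum \<open>Suc L - m\<close>, changing the cycle by boundaries only.\<close>

lemma cycle_is_boundary:
  fixes c :: "'v list \<Rightarrow>\<^sub>0 'k::field"
  assumes m: "0 < m" "m < L"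
    and a: "1 \<le> a" "a + m \<le> Suc L"
    and "Poly_Mapping.keys c \<subseteq> (\<Union>b\<in>{a..Suc L - m}. layered b m)"
    and "boundary c = 0"
  shows "c \<in> boundaries (mlp_digraph L K) (int m - 1)"
  using a(2,1) assms(5,6)
proof (induction "Suc L - m - a" arbitrary: a c)
  case 0
  then have a: "a = Suc L - m" by simp
  \<comment> \<open>All paths now start in the same layer \<open>a\<close>, which exceeds \<open>1\<close> because \<open>m < L\<close>: there is room
    for a cone at the front.\<close>
  have "K (a - 1) \<noteq> {}" using a m by (intro nonempty) auto
  then obtain e where e: "e \<in> K (a - 1)" by blast
  let ?w = "cone_front e c"
  have supp: "Poly_Mapping.keys c \<subseteq> layered a m" using 0 a by simp
  have w: "boundary ?w = c"
    using 0 by (simp add: boundary_cone_front)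
  have "Poly_Mapping.keys ?w \<subseteq> layered (a - 1) (Suc m)"
  proof -
    have "Suc (a - 1) = a" using a m by simp
    then have "(#) e ` Poly_Mapping.keys c \<subseteq> layered (a - 1) (Suc m)"
      using supp e cons_layered[of e "a - 1" _ m] by auto
    then show ?thesis using keys_cone_front[of e c] by blast
  qed
  moreover have "layered (a - 1) (Suc m) \<subseteq> allowed_paths (mlp_digraph L K) (int m - 1 + 1)"
    using layered_subset_allowed_paths[of "a - 1" "Suc m"] a m by simp
  moreover have "layered a m \<subseteq> allowed_paths (mlp_digraph L K) (int m - 1)"
    using layered_subset_allowed_paths[of a m] a m by simp
  ultimately have "boundary ?w \<in> boundaries (mlp_digraph L K) (int m - 1)"
    using supp by (intro boundariesI) (auto simp: w)
  then show ?case using w by simp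
next
  case (Suc d)
  then have a: "1 \<le> a" "a + m \<le> L" by auto
  have "K (a + m) \<noteq> {}" using a by (intro nonempty) auto
  then obtain e where e: "e \<in> K (a + m)" by blast
  \<comment> \<open>Pushing along the identity with a \<open>0\<close>-\<open>1\<close> weight restricts the support: \<open>c1\<close> is the part of \<open>c\<close>
    that starts exactly in layer \<open>a\<close>.\<close>
  define c1 where "c1 = push id (\<lambda>xs. if xs \<in> layered a m then 1 else 0) c"
  have lookup_c1: "Poly_Mapping.lookup c1 xs =
      (if xs \<in> layered a m then Poly_Mapping.lookup c xs else 0)" for xs
    using lookup_push_inj[of id _ c xs] by (simp add: c1_def)
  have supp1: "Poly_Mapping.keys c1 \<subseteq> layered a m"
    by (auto simp: in_keys_iff lookup_c1 split: if_splits)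
  have supp2: "Poly_Mapping.keys (c - c1) \<subseteq> (\<Union>b\<in>{Suc a..Suc L - m}. layered b m)"
  proof
    fix xs assume "xs \<in> Poly_Mapping.keys (c - c1)"
    then have "xs \<in> Poly_Mapping.keys c" "xs \<notin> layered a m"
      by (auto simp: in_keys_iff lookup_minus lookup_c1 split: if_splits)
    then show "xs \<in> (\<Union>b\<in>{Suc a..Suc L - m}. layered b m)"
      using Suc.prems(3) by (fastforce simp: le_eq_less_or_eq)
  qed
  have bd1: "Poly_Mapping.keys (boundary c1) \<subseteq> layered (Suc a) (m - 1)"
  proof
    fix ys assume ys: "ys \<in> Poly_Mapping.keys (boundary c1)"
    then obtain xs i where xs: "xs \<in> Poly_Mapping.keys c1" "i < length xs"
      "ys = take i xs @ drop (Suc i) xs" by (rule keys_boundary)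
    then have xs_a: "xs \<in> layered a m" using supp1 by blast
    show "ys \<in> layered (Suc a) (m - 1)"
    proof (cases "i = 0")
      case True
      have "xs ! Suc k \<in> K (Suc (a + k))" if "k < m - 1" for k
      proof -
        have "Suc k < m" using that by simp
        then have "xs ! Suc k \<in> K (a + Suc k)" using xs_a unfolding layered_def by blast
        then show ?thesis by simp
      qed
      then show ?thesis using xs xs_a True by (auto simp: layered_def)
    next
      case False
      \<comment> \<open>Omitting a later vertex leaves a path that starts in layer \<open>a\<close>. As \<open>c\<close> is a cycle, it is also
        a face of \<open>c - c1\<close>, but those start in later layers.\<close>
      have "boundary c1 = - boundary (c - c1)"
        using Suc.prems(4) by (simp add: boundary_diff)
      then have "ys \<in> Poly_Mapping.keys (boundary (c - c1))" using ys by simp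
      then obtain xs' i' where xs': "xs' \<in> Poly_Mapping.keys (c - c1)" "i' < length xs'"
        "ys = take i' xs' @ drop (Suc i') xs'" by (rule keys_boundary)
      then obtain b where b: "b \<in> {Suc a..Suc L - m}" "xs' \<in> layered b m" using supp2 by blast
      have len: "length xs = m" "length xs' = m" "i < m" "i' < m"
        using xs xs' xs_a b by (auto simp: layered_def)
      have "ys ! 0 = xs ! 0" using xs False by (auto simp: nth_append)
      then have "ys ! 0 \<in> K a" using xs_a m by (auto simp: layered_def)
      moreover have "ys ! 0 = xs' ! (if i' = 0 then 1 else 0)"
        using xs' len False by (auto simp: nth_append)
      then have "ys ! 0 \<in> K (b + (if i' = 0 then 1 else 0))"
        using b len False by (auto simp: layered_def)
      ultimately have "a = b + (if i' = 0 then 1 else 0)"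
        using a b len False by (intro layer_unique) auto
      then show ?thesis using b by simp
    qed
  qed
  \<comment> \<open>The boundary of \<open>?w\<close> is \<open>c1\<close> up to the remainder \<open>?r\<close>, which starts in the next layer.\<close>
  let ?w = "cone_back e c1"
  let ?r = "cone_back e (boundary c1)"
  have w: "boundary ?w = c1 - ?r" by (rule boundary_cone_back)
  have supp_r: "Poly_Mapping.keys ?r \<subseteq> layered (Suc a) m"
  proof -
    have "(\<lambda>xs. xs @ [e]) ` Poly_Mapping.keys (boundary c1) \<subseteq> layered (Suc a) m"
      using bd1 e m snoc_layered[of _ "Suc a" "m - 1" e] by auto
    then show ?thesis using keys_cone_back[of e "boundary c1"] by blast
  qed
  have "Poly_Mapping.keys ?w \<subseteq> layered a (Suc m)"
    using keys_cone_back[of e c1] supp1 snoc_layered[of _ a m e] e by blast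
  moreover have "Poly_Mapping.keys (boundary ?w) \<subseteq> layered a m \<union> layered (Suc a) m"
    using w keys_diff_subset[of c1 ?r] supp1 supp_r by auto
  moreover have "layered a (Suc m) \<subseteq> allowed_paths (mlp_digraph L K) (int m - 1 + 1)"
    using layered_subset_allowed_paths[of a "Suc m"] a by simp
  moreover have "layered a m \<subseteq> allowed_paths (mlp_digraph L K) (int m - 1)"
    "layered (Suc a) m \<subseteq> allowed_paths (mlp_digraph L K) (int m - 1)"
    using layered_subset_allowed_paths[of a m] layered_subset_allowed_paths[of "Suc a" m] a by auto
  ultimately have "boundary ?w \<in> boundaries (mlp_digraph L K) (int m - 1)"
    by (intro boundariesI) auto
  moreover have "c - boundary ?w \<in> boundaries (mlp_digraph L K) (int m - 1)"
  proof (rule Suc.hyps(1))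
    show "d = Suc L - m - Suc a" "Suc a + m \<le> Suc L" "1 \<le> Suc a" using Suc.hyps(2) a by auto
    have eq: "c - boundary ?w = (c - c1) + ?r" using w by simp
    have sub: "layered (Suc a) m \<subseteq> (\<Union>b\<in>{Suc a..Suc L - m}. layered b m)"
      by (rule UN_upper) (use a in auto)
    show "Poly_Mapping.keys (c - boundary ?w) \<subseteq> (\<Union>b\<in>{Suc a..Suc L - m}. layered b m)"
      unfolding eq by (rule order.trans[OF keys_add Un_least[OF supp2 order.trans[OF supp_r sub]]])
    show "boundary (c - boundary ?w) = 0"
      using Suc.prems(4) by (simp add: boundary_diff boundary_boundary)
  qed
  ultimately have "(c - boundary ?w) + boundary ?w \<in> boundaries (mlp_digraph L K) (int m - 1)"
    by (intro add_in_boundaries)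
  then show ?case by simp
qed

lemma path_homology_off_top:
  assumes "0 \<le> p" "p \<noteq> int L - 1"
  shows "vectorspace.fin_dim (class_ring :: 'k::field ring) (path_homology (mlp_digraph L K) p) \<and>
    vectorspace.dim (class_ring :: 'k ring) (path_homology (mlp_digraph L K) p) = 0"
proof -
  define m where "m = nat (p + 1)"
  have m: "p = int m - 1" "0 < m" "m \<noteq> L" using assms by (auto simp: m_def)
  have "c \<in> boundaries (mlp_digraph L K) p" if c: "c \<in> cycles (mlp_digraph L K) p"
    for c :: "'v list \<Rightarrow>\<^sub>0 'k"
  proof (cases "m < L")
    case True
    then show ?thesis using cycle_is_boundary[of m 1 c] c m allowed_paths_eq[of m]
      by (auto simp: cycles_eq)
  next
    case False
    then have "allowed_paths (mlp_digraph L K) p = {}" using m allowed_paths_eq[of m] by auto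
    then have "c = 0" using c by (simp add: cycles_eq)
    then show ?thesis by (auto simp: boundaries_def intro!: image_eqI[of _ _ 0] zero_in_Omega)
  qed
  \<comment> \<open>So the empty family represents a basis.\<close>
  then show ?thesis
    using path_homology_dim[of "{}" "\<lambda>_. 0" "mlp_digraph L K" p] by auto
qed

lemma path_homology_top:
  "vectorspace.fin_dim (class_ring :: 'k::field ring) (path_homology (mlp_digraph L K) (int L - 1)) \<and>
    vectorspace.dim (class_ring :: 'k ring) (path_homology (mlp_digraph L K) (int L - 1)) =
      (\<Prod>i=1..L. card (K i) - 1)"
proof -
  let ?G = "mlp_digraph L K"
  \<comment> \<open>Layers are renumbered from \<open>0\<close>, to match the positions in a list.\<close>
  define A where "A i = K (Suc i)" for i
  define e where "e i = (SOME x. x \<in> A i)" for i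
  define es where "es = map e [0..<L]"
  define P where "P = {xs. length xs = L \<and> (\<forall>i<L. xs ! i \<in> A i)}"
  define Z where "Z = {xs. length xs = L \<and> (\<forall>i<L. xs ! i \<in> A i - {e i})}"
  have e: "e i \<in> A i" if "i < L" for i
    using nonempty[of "Suc i"] that by (auto simp: e_def A_def intro: someI_ex)
  have finA: "finite (A i)" if "i < L" for i
    using fin[of "Suc i"] that by (auto simp: A_def)
  have disjA: "A i \<inter> A (Suc i) = {}" if "Suc i < L" for i
    using layer_unique[of _ "Suc i" "Suc (Suc i)"] that by (auto simp: A_def)
  have allowed: "allowed_paths ?G (int L - 1) = P"
    using allowed_paths_eq[of L] by (simp add: layered_def P_def A_def Suc_diff_le)
  have "allowed_paths ?G (int L) = {}"
    using allowed_paths_eq[of "Suc L"] by simp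
  then have boundaries: "boundaries ?G (int L - 1) = {0 :: 'v list \<Rightarrow>\<^sub>0 'k}"
    using zero_in_Omega[of ?G "int L"] by (auto simp: boundaries_def Omega_def allowed_space_eq)
  have finZ: "finite Z" and "card Z = (\<Prod>i<L. card (A i - {e i}))"
    unfolding Z_def using finA by (intro finite_lists_nth_in; simp)+
  then have cardZ: "card Z = (\<Prod>i=1..L. card (K i) - 1)"
    using e by (simp add: card_Diff_singleton_if A_def prod.atLeast1_atMost_eq)
  have keys: "Poly_Mapping.keys (join_cycle es z :: 'v list \<Rightarrow>\<^sub>0 'k) \<subseteq> P" if "z \<in> Z" for z
    using keys_join_cycle[of es z] that e by (fastforce simp: Z_def P_def es_def)
  have lookup: "Poly_Mapping.lookup (join_cycle es z :: 'v list \<Rightarrow>\<^sub>0 'k) y = (if y = z then 1 else 0)"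
    if "z \<in> Z" "y \<in> Z" for y z
    using that by (intro lookup_join_cycle) (auto simp: Z_def es_def)
  have lookup_comb: "Poly_Mapping.lookup (\<Sum>z\<in>Z. scale (a z) (join_cycle es z)) y = a y"
    if "y \<in> Z" for y and a :: "'v list \<Rightarrow> 'k"
  proof -
    have "Poly_Mapping.lookup (\<Sum>z\<in>Z. scale (a z) (join_cycle es z)) y =
        (\<Sum>z\<in>Z. if y = z then a z else 0)"
      unfolding lookup_sum by (intro sum.cong) (auto simp: lookup that)
    then show ?thesis using that finZ by simp
  qed
  have "vectorspace.fin_dim (class_ring :: 'k ring) (path_homology ?G (int L - 1)) \<and>
    vectorspace.dim (class_ring :: 'k ring) (path_homology ?G (int L - 1)) = card Z"
  proof (rule path_homology_dim[where b = "join_cycle es", OF finZ])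
    show "join_cycle es z \<in> (cycles ?G (int L - 1) :: ('v list \<Rightarrow>\<^sub>0 'k) set)" if "z \<in> Z" for z
      using keys[OF that] by (simp add: cycles_eq allowed boundary_join_cycle)
  next
    fix a :: "'v list \<Rightarrow> 'k"
    assume "(\<Sum>z\<in>Z. scale (a z) (join_cycle es z)) \<in> boundaries ?G (int L - 1)"
    then have "(\<Sum>z\<in>Z. scale (a z) (join_cycle es z)) = 0" by (simp add: boundaries)
    then show "\<forall>z\<in>Z. a z = 0" using lookup_comb[of _ a] by simp
  next
    fix c :: "'v list \<Rightarrow>\<^sub>0 'k"
    assume c: "c \<in> cycles ?G (int L - 1)"
    let ?s = "\<Sum>z\<in>Z. scale (Poly_Mapping.lookup c z) (join_cycle es z)"
    \<comment> \<open>By duality \<open>?s\<close> agrees with \<open>c\<close> at all tuples avoiding the base vertices.\<close>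
    have "c - ?s = 0"
    proof (rule cycle_eq_0I[where n = L and A = A and e = e, OF finA disjA])
      have "Poly_Mapping.keys ?s \<subseteq> P"
        using keys
        by (intro order.trans[OF keys_sum_subset] UN_least order.trans[OF keys_map_times]) blast
      then show "Poly_Mapping.keys (c - ?s) \<subseteq> {xs. length xs = L \<and> (\<forall>i<L. xs ! i \<in> A i)}"
        using c keys_diff_subset[of c ?s] by (auto simp: cycles_eq allowed P_def)
      show "boundary (c - ?s) = 0"
        using c by (simp add: cycles_eq boundary_diff boundary_sum boundary_smult boundary_join_cycle)
      show "Poly_Mapping.lookup (c - ?s) xs = 0"
        if "length xs = L" "\<forall>i<L. xs ! i \<in> A i - {e i}" for xs
        using lookup_comb[of xs] that by (simp add: Z_def lookup_minus)
    qed (use e in auto)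
    then show "\<exists>a. c - (\<Sum>z\<in>Z. scale (a z) (join_cycle es z)) \<in> boundaries ?G (int L - 1)"
      by (auto simp: boundaries)
  qed
  then show ?thesis by (simp add: cardZ)
qed

end

theorem theorem1:
  fixes L :: nat and n :: "nat \<Rightarrow> nat" and K :: "nat \<Rightarrow> 'v set" and p :: int
  assumes "1 \<le> L"
    and "\<And>i. i \<in> {1..L} \<Longrightarrow> 1 \<le> n i"
    and "\<And>i. i \<in> {1..L} \<Longrightarrow> finite (K i) \<and> card (K i) = n i"
    and "disjoint_family_on K {1..L}"
    and "0 \<le> p"
  shows "vectorspace.fin_dim (class_ring :: 'k::field ring) (path_homology (mlp_digraph L K) p) \<and>
    vectorspace.dim (class_ring :: 'k ring) (path_homology (mlp_digraph L K) p) =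
      (if p = int L - 1 then (\<Prod>i=1..L. (n i - 1)) else 0)"
proof -
  have "K i \<noteq> {}" if "i \<in> {1..L}" for i using assms(2,3)[OF that] by auto
  then interpret network_layers L K
    using assms by unfold_locales auto
  have "(\<Prod>i=1..L. card (K i) - 1) = (\<Prod>i=1..L. n i - 1)"
    using assms(3) by (intro prod.cong) auto
  then show ?thesis
    using path_homology_top path_homology_off_top[OF assms(5)] by (cases "p = int L - 1") auto
qed

end
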